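(* If $X$ is a topological space and $f:X\to\mathbb{R}$ is a locally extremal function, then $|f(X)|\le R(X)$, where $R(X)$ is the weak separate number of $X$.
   Context: A function $f:X\to\mathbb{R}$ on a topological space $X$ is locally extremal if each point $x\in X$ is a point of local minimum or local maximum for $f$; that is, for each $x\in X$ there is a neighborhood $O$ of $x$ in $X$ such that either $f(x)\le f(y)$ for all $y\in O$, or $f(x)\ge f(y)$ for all $y\in O$. A topological space $Y$ is weakly separated if each point $x\in Y$ has an open neighborhood $O_x\subset Y$ such that for any two distinct points $x,y\in Y$ either $x\notin O_y$ or $y\notin O_x$. The weak separate number of a topological space $X$ is the cardinal $$R(X)=\sup\{|Y| : Y \text{ is a weakly separated subspace of } X\}.$$ Here $|A|$ denotes the cardinality of a set $A$.
   Formalization: The formal theorem additionally assumes that X is T0 or f(X) is infinite, since the claim fails for an injective real function on the two-point indiscrete space, where |f(X)| = 2 but R(X) = 1. *)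

theory Defs
  imports "HOL-Analysis.Analysis"
begin

unbundle cardinal_syntax

definition locally_extremal :: "'a topology \<Rightarrow> ('a \<Rightarrow> real) \<Rightarrow> bool" where
  "locally_extremal X f \<longleftrightarrow>
     (\<forall>x\<in>topspace X. \<exists>N\<subseteq>topspace X. x \<in> X interior_of N \<and>
        ((\<forall>y\<in>N. f x \<le> f y) \<or> (\<forall>y\<in>N. f x \<ge> f y)))"

definition weakly_separated_space :: "'a topology \<Rightarrow> bool" where
  "weakly_separated_space Y \<longleftrightarrow>
     (\<exists>N. (\<forall>x\<in>topspace Y. openin Y (N x) \<and> x \<in> N x) \<and>
          (\<forall>x\<in>topspace Y. \<forall>y\<in>topspace Y. x \<noteq> y \<longrightarrow> x \<notin> N y \<or> y \<notin> N x))"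

text \<open>Cardinals are represented by cardinal orders, so a supremum is determined only up to
  the equivalence \<open>=o\<close>. The supremum of a family of cardinal orders on a type is again
  representable on that type; by \<open>cSup_least\<close> below it is least among upper bounds on
  arbitrary types.\<close>

definition is_cSup :: "'a rel set \<Rightarrow> 'a rel \<Rightarrow> bool" where
  "is_cSup C r \<longleftrightarrow> Card_order r \<and> (\<forall>s\<in>C. s \<le>o r) \<and>
     (\<forall>r'::'a rel. Card_order r' \<and> (\<forall>s\<in>C. s \<le>o r') \<longrightarrow> r \<le>o r')"

definition cSup :: "'a rel set \<Rightarrow> 'a rel" where
  "cSup C = (SOME r. is_cSup C r)"

lemma is_cSup_cSup:
  fixes C :: "'a rel set"
  assumes "\<And>s. s \<in> C \<Longrightarrow> Card_order s"
  shows "is_cSup C (cSup C)"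
proof -
  let ?U = "{r::'a rel. Card_order r \<and> (\<forall>s\<in>C. s \<le>o r)}"
  have "|UNIV :: 'a set| \<in> ?U"
  proof -
    have "s \<le>o |UNIV :: 'a set|" if "s \<in> C" for s
    proof -
      have "s =o |Field s|"
        using card_of_Field_ordIso[OF assms[OF that]] ordIso_symmetric by blast
      moreover have "|Field s| \<le>o |UNIV :: 'a set|" by (rule card_of_mono1) simp
      ultimately show ?thesis using ordIso_ordLeq_trans by blast
    qed
    then show ?thesis by (simp add: card_of_Card_order)
  qed
  then obtain r where r: "r \<in> ?U" and min: "\<And>r'. (r', r) \<in> ordLess \<Longrightarrow> r' \<notin> ?U"
    by (rule wfE_min[OF wf_ordLess]) blast
  have "r \<le>o r'" if "r' \<in> ?U" for r'
  proof -
    have "Well_order r" "Well_order r'"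
      using r that by (auto simp: card_order_on_def)
    moreover have "(r', r) \<notin> ordLess" using min that by blast
    ultimately show ?thesis using ordLess_or_ordLeq by blast
  qed
  then have "is_cSup C r"
    using r unfolding is_cSup_def by blast
  then show ?thesis
    unfolding cSup_def by (rule someI)
qed

lemma Card_order_cSup: "(\<And>s. s \<in> C \<Longrightarrow> Card_order s) \<Longrightarrow> Card_order (cSup C)"
  using is_cSup_cSup[of C] unfolding is_cSup_def by blast

lemma cSup_upper: "(\<And>s. s \<in> C \<Longrightarrow> Card_order s) \<Longrightarrow> s \<in> C \<Longrightarrow> s \<le>o cSup C"
  using is_cSup_cSup[of C] unfolding is_cSup_def by blast

lemma cSup_least:
  fixes C :: "'a rel set" and r :: "'b rel"
  assumes C: "\<And>s. s \<in> C \<Longrightarrow> Card_order s" and r: "Card_order r"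
    and ub: "\<And>s. s \<in> C \<Longrightarrow> s \<le>o r"
  shows "cSup C \<le>o r"
proof (rule ccontr)
  assume *: "\<not> cSup C \<le>o r"
  have "r \<le>o cSup C"
  proof -
    have "Well_order r" "Well_order (cSup C)"
      using r Card_order_cSup[OF C] by (auto simp: card_order_on_def)
    then show ?thesis using * ordLeq_total by blast
  qed
  moreover have "|Field r| =o r" "|Field (cSup C)| =o cSup C"
    using r Card_order_cSup[OF C] card_of_Field_ordIso by blast+
  ultimately have "|Field r| \<le>o |Field (cSup C)|"
    by (meson ordIso_ordLeq_trans ordIso_symmetric ordLeq_ordIso_trans)
  then obtain g where g: "inj_on g (Field r)" "g ` Field r \<subseteq> Field (cSup C)"
    using card_of_ordLeq[of "Field r" "Field (cSup C)"] by blast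
  have eq: "|g ` Field r| =o r"
  proof -
    have "|Field r| =o |g ` Field r|"
      using g(1) card_of_ordIso bij_betw_def by blast
    then show ?thesis
      using \<open>|Field r| =o r\<close> ordIso_symmetric ordIso_transitive by blast
  qed
  have "s \<le>o |g ` Field r|" if "s \<in> C" for s
    using ub[OF that] eq ordIso_symmetric ordLeq_ordIso_trans by blast
  then have "cSup C \<le>o |g ` Field r|"
    using is_cSup_cSup[OF C] card_of_Card_order unfolding is_cSup_def by blast
  then show False
    using * eq ordLeq_ordIso_trans by blast
qed

definition weak_separate_number :: "'a topology \<Rightarrow> 'a rel" where
  "weak_separate_number X =
     cSup {|Y| | Y. Y \<subseteq> topspace X \<and> weakly_separated_space (subtopology X Y)}"

text \<open>For finite \<open>f ` topspace X\<close> the inequality \<open>|f ` topspace X| \<le>o weak_separate_number X\<close>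
  can fail for spaces that are not T0: an injection of the indiscrete two-point space into
  the reals is locally extremal and has two values, but all weakly separated subspaces have at
  most one point.\<close>

lemma indiscrete_counterexample:
  fixes X :: "bool topology"
  defines "X \<equiv> topology (\<lambda>S. S = {} \<or> S = UNIV)"
  shows "locally_extremal X of_bool"
    and "\<not> |(of_bool :: bool \<Rightarrow> real) ` topspace X| \<le>o weak_separate_number X"
proof -
  have "istopology (\<lambda>S::bool set. S = {} \<or> S = UNIV)"
    unfolding istopology_def by auto
  then have op: "openin X S \<longleftrightarrow> S = {} \<or> S = UNIV" for S
    unfolding X_def by (simp add: topology_inverse')
  have top: "topspace X = UNIV"
    unfolding topspace_def by (auto simp: op)
  have int: "X interior_of UNIV = UNIV"
    using interior_of_topspace[of X] by (simp add: top)
  have "(\<forall>y\<in>UNIV. of_bool x \<le> (of_bool y :: real)) \<or> (\<forall>y\<in>UNIV. of_bool x \<ge> (of_bool y :: real))"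
    for x by (cases x) auto
  then show "locally_extremal X of_bool"
    unfolding locally_extremal_def top by (intro ballI exI[of _ UNIV]) (simp add: int)
  have le: "|Y| \<le>o |{()}|" if Y: "weakly_separated_space (subtopology X Y)" for Y
  proof -
    obtain N where N: "\<And>x. x \<in> Y \<Longrightarrow> openin (subtopology X Y) (N x) \<and> x \<in> N x"
      and sep: "\<And>x y. x \<in> Y \<Longrightarrow> y \<in> Y \<Longrightarrow> x \<noteq> y \<Longrightarrow> x \<notin> N y \<or> y \<notin> N x"
      using Y unfolding weakly_separated_space_def topspace_subtopology top by auto
    have NY: "N x = Y" if "x \<in> Y" for x
      using N[OF that] unfolding openin_subtopology op by auto
    have "x = y" if "x \<in> Y" "y \<in> Y" for x y
      using NY that sep[OF that] by blast
    then have "inj_on (\<lambda>_. ()) Y" by (auto simp: inj_on_def)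
    then show ?thesis using card_of_ordLeq[of Y "{()}"] by auto
  qed
  have "weak_separate_number X \<le>o |{()}|"
    unfolding weak_separate_number_def
    by (rule cSup_least) (auto intro: le simp: card_of_Card_order)
  moreover have "\<not> |(of_bool :: bool \<Rightarrow> real) ` topspace X| \<le>o |{()}|"
  proof
    assume "|(of_bool :: bool \<Rightarrow> real) ` topspace X| \<le>o |{()}|"
    then obtain g :: "real \<Rightarrow> unit" where "inj_on g (of_bool ` topspace X)"
      unfolding card_of_ordLeq[symmetric] by blast
    then have "(of_bool True :: real) = of_bool False"
      unfolding top by (rule inj_onD) auto
    then show False by simp
  qed
  ultimately show "\<not> |(of_bool :: bool \<Rightarrow> real) ` topspace X| \<le>o weak_separate_number X"
    using ordLeq_transitive by blast
qed

end

(* Choose one point for each value of f. For two chosen local minima (or two local maxima), each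
   lying in the other's extremal neighborhood, the values agree, so the points coincide; hence the
   chosen points form a union of two weakly separated subspaces, which suffices for infinite f(X).
   For finite f(X), every finite T0 subspace is weakly separated by its minimal neighborhoods. *)
theory Submission
  imports Defs
begin

text \<open>Passing to the traces \<open>Y \<inter> N x\<close> lets the neighborhoods be chosen
  open in \<open>X\<close> itself; the separation condition appears in contrapositive form.\<close>

lemma weakly_separated_subtopologyI:
  assumes "\<And>x. x \<in> Y \<Longrightarrow> openin X (N x) \<and> x \<in> N x"
    and "\<And>x y. x \<in> Y \<Longrightarrow> y \<in> Y \<Longrightarrow> x \<in> N y \<Longrightarrow> y \<in> N x \<Longrightarrow> x = y"
  shows "weakly_separated_space (subtopology X Y)"
proof -
  have "openin (subtopology X Y) (Y \<inter> N x) \<and> x \<in> Y \<inter> N x" if "x \<in> Y" for x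
    using assms(1)[OF that] that by (simp add: openin_subtopology_Int2)
  moreover have "x \<notin> Y \<inter> N y \<or> y \<notin> Y \<inter> N x" if "x \<in> Y" "y \<in> Y" "x \<noteq> y" for x y
    using assms(2) that by blast
  ultimately show ?thesis
    unfolding weakly_separated_space_def topspace_subtopology
    by (intro exI[of _ "\<lambda>x. Y \<inter> N x"]) blast
qed

lemma weakly_separated_le_weak_separate_number:
  assumes "Y \<subseteq> topspace X" "weakly_separated_space (subtopology X Y)"
  shows "|Y| \<le>o weak_separate_number X"
  unfolding weak_separate_number_def
  by (rule cSup_upper) (use assms in \<open>auto simp: card_of_Card_order\<close>)

lemma Card_order_weak_separate_number: "Card_order (weak_separate_number X)"
  unfolding weak_separate_number_def
  by (rule Card_order_cSup) (auto simp: card_of_Card_order)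

text \<open>Witness neighborhoods are the interiors of the sets on which \<open>f\<close> is minimal
  at the given point. Mutual membership yields both inequalities between \<open>f x\<close> and
  \<open>f y\<close>, and injectivity finishes. Local maxima are handled by applying this to the
  negated function.\<close>

lemma weakly_separated_local_minima:
  fixes f :: "'a \<Rightarrow> real"
  assumes inj: "inj_on f Y"
    and min: "\<And>x. x \<in> Y \<Longrightarrow> \<exists>N. x \<in> X interior_of N \<and> (\<forall>y\<in>N. f x \<le> f y)"
  shows "weakly_separated_space (subtopology X Y)"
proof -
  obtain N where N: "\<And>x. x \<in> Y \<Longrightarrow> x \<in> X interior_of N x \<and> (\<forall>y\<in>N x. f x \<le> f y)"
    using min by metis
  show ?thesis
  proof (rule weakly_separated_subtopologyI)
    fix x y assume xy: "x \<in> Y" "y \<in> Y" "x \<in> X interior_of N y" "y \<in> X interior_of N x"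
    then have "x \<in> N y" "y \<in> N x"
      using interior_of_subset by (metis subsetD)+
    then have "f x = f y"
      using N xy by (meson order_antisym)
    then show "x = y"
      using inj xy by (meson inj_onD)
  qed (use N in auto)
qed

text \<open>The neighborhood of \<open>x\<close> is a finite intersection of open sets
  \<open>U x y\<close>, each omitting \<open>y\<close> whenever some open set around
  \<open>x\<close> does. Two points in each other's neighborhoods are then topologically
  indistinguishable, hence equal by T0.\<close>

lemma weakly_separated_finite_t0:
  assumes t0: "t0_space X" and fin: "finite Y" and Y: "Y \<subseteq> topspace X"
  shows "weakly_separated_space (subtopology X Y)"
proof -
  \<comment> \<open>If \<open>y\<close> lies in every open set around \<open>x\<close>, take
    \<open>topspace X\<close>; otherwise take an open set around \<open>x\<close> that misses
    \<open>y\<close>.\<close>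
  have "\<exists>U. openin X U \<and> x \<in> U \<and> (y \<in> U \<longrightarrow> (\<forall>V. openin X V \<and> x \<in> V \<longrightarrow> y \<in> V))"
    if "x \<in> Y" for x y
    using that Y by (cases "\<forall>V. openin X V \<and> x \<in> V \<longrightarrow> y \<in> V") auto
  then obtain U where U: "\<And>x y. x \<in> Y \<Longrightarrow> openin X (U x y) \<and> x \<in> U x y \<and>
      (y \<in> U x y \<longrightarrow> (\<forall>V. openin X V \<and> x \<in> V \<longrightarrow> y \<in> V))"
    by metis
  show ?thesis
  proof (rule weakly_separated_subtopologyI)
    show "openin X (\<Inter>y\<in>Y. U x y) \<and> x \<in> (\<Inter>y\<in>Y. U x y)" if "x \<in> Y" for x
    proof (intro conjI openin_INT2)
      show "openin X (U x y)" for y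
        using U[OF that] by (rule conjunct1)
      show "x \<in> (\<Inter>y\<in>Y. U x y)"
        using U[OF that] by blast
    qed (use fin that in auto)
    fix x y assume xy: "x \<in> Y" "y \<in> Y" "x \<in> (\<Inter>z\<in>Y. U y z)" "y \<in> (\<Inter>z\<in>Y. U x z)"
    then have "y \<in> U x y" "x \<in> U y x"
      by blast+
    then have "x \<in> V \<longleftrightarrow> y \<in> V" if "openin X V" for V
      using U[OF xy(1), of y] U[OF xy(2), of x] that by meson
    moreover have "x \<in> topspace X" "y \<in> topspace X"
      using xy(1,2) Y by auto
    ultimately show "x = y"
      using t0 unfolding t0_space_def by metis
  qed
qed

theorem theorem1:
  fixes X :: "'a topology" and f :: "'a \<Rightarrow> real"
  assumes "locally_extremal X f"
    and "t0_space X \<or> infinite (f ` topspace X)"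
  shows "|f ` topspace X| \<le>o weak_separate_number X"
proof -
  let ?R = "weak_separate_number X"
  \<comment> \<open>\<open>Y\<close> is a transversal of the fibres of \<open>f\<close>, so bounding
    \<open>|Y|\<close> bounds the number of values.\<close>
  obtain Y where Y: "Y \<subseteq> topspace X" "inj_on f Y" "f ` topspace X = f ` Y"
    using subset_image_inj[of "f ` topspace X" f "topspace X"] by auto
  have "|Y| \<le>o ?R"
  proof (cases "finite Y")
    case True
    then have "t0_space X"
      using assms(2) Y(3) by simp
    then show ?thesis
      using True Y(1) weakly_separated_finite_t0 weakly_separated_le_weak_separate_number by blast
  next
    case False
    define A where "A = {x\<in>Y. \<exists>N. x \<in> X interior_of N \<and> (\<forall>y\<in>N. f x \<le> f y)}"
    \<comment> \<open>Local maxima are phrased as local minima of \<open>- f\<close>, so that one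
      lemma serves both halves.\<close>
    define B where "B = {x\<in>Y. \<exists>N. x \<in> X interior_of N \<and> (\<forall>y\<in>N. - f x \<le> - f y)}"
    have AB: "Y = A \<union> B"
    proof
      show "Y \<subseteq> A \<union> B"
      proof
        fix x assume "x \<in> Y"
        then obtain N where "x \<in> X interior_of N" "(\<forall>y\<in>N. f x \<le> f y) \<or> (\<forall>y\<in>N. f x \<ge> f y)"
          using assms(1) Y(1) unfolding locally_extremal_def by blast
        then show "x \<in> A \<union> B"
          using \<open>x \<in> Y\<close> unfolding A_def B_def neg_le_iff_le by blast
      qed
    qed (auto simp: A_def B_def)
    have inj: "inj_on f A" "inj_on (\<lambda>x. - f x) B"
      using Y(2) unfolding A_def B_def inj_on_def by auto
    have "weakly_separated_space (subtopology X A)"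
      by (rule weakly_separated_local_minima[OF inj(1)]) (simp add: A_def)
    moreover have "weakly_separated_space (subtopology X B)"
      by (rule weakly_separated_local_minima[OF inj(2)]) (simp add: B_def)
    ultimately have le: "|A| \<le>o ?R" "|B| \<le>o ?R"
      using weakly_separated_le_weak_separate_number Y(1) AB by blast+
    \<comment> \<open>A union of two sets of size at most \<open>?R\<close> is again bounded by
      \<open>?R\<close> once \<open>?R\<close> is infinite. A finite \<open>?R\<close> would make
      \<open>A\<close> and \<open>B\<close>, and hence \<open>Y\<close>, finite.\<close>
    have "infinite (Field ?R)"
    proof
      assume "finite (Field ?R)"
      then have "finite A" "finite B"
        using le card_of_ordLeq_finite[of _ "Field ?R"]
          card_of_Field_ordIso[OF Card_order_weak_separate_number[of X]]
        by (meson ordIso_symmetric ordLeq_ordIso_trans)+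
      then show False
        using False AB by simp
    qed
    then show ?thesis
      unfolding AB using le Card_order_weak_separate_number
      by (intro card_of_Un_ordLeq_infinite_Field)
  qed
  then show ?thesis
    unfolding Y(3) using card_of_image ordLeq_transitive by blast
qed

end
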